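(* For any unimodal range map $\delta$, the partial composition maps $\circ_i$ on $\mathbf{Cl}_\delta$ satisfy, for any $u,v\in\mathsf{Cl}_\delta$ and $1\le i\le|u|$, $$\mathsf{H}_u\circ_i\mathsf{H}_v=\mathsf{H}_{\mathrm{r}_\delta(u\,\blacksquare_i\,v)} .$$
   Context: $\mathbb{N}=\{0,1,2,\dots\}$ and $\mathbb{K}$ is a field of characteristic zero. A range map is a map $\delta:\mathbb{N}\setminus\{0\}\to\mathbb{N}$. It is unimodal if there are no $1\le i_1<i_2<i_3$ with $\delta(i_1)>\delta(i_2)<\delta(i_3)$. For a word $w$ on $\mathbb{N}$, $\ell(w)$ is its length, $w(i)$ its $i$-th letter, $\epsilon$ is the empty word. A $\delta$-cliff is a word $w$ on $\mathbb{N}$ with $0\le w(i)\le\delta(i)$ for all $i$; its size is $|w|:=\ell(w)+1$; $\mathsf{Cl}_\delta$ is the graded set of all $\delta$-cliffs. The $\delta$-reduction of a word $w$ on $\mathbb{N}$ is the $\delta$-cliff $\mathrm{r}_\delta(w)$ of length $\ell(w)$ with $i$-th letter $\min\{w(i),\delta(i)\}$. For words $u,v$ and $1\le i\le|u|$, $u\,\square_i\,v:=u(1)\cdots u(i-1)\;v\;u(i)\cdots u(\ell(u))$. For $\delta$ unimodal, $\mathbf{Cl}_\delta$ is the nonsymmetric operad over $\mathbb{K}$ with basis $\{\mathsf{E}_w:w\in\mathsf{Cl}_\delta\}$ ($\mathsf{E}_w$ of arity $|w|$), partial compositions $\mathsf{E}_u\circ_i\mathsf{E}_v=\mathsf{E}_{u\,\square_i\,v}$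 if $u\,\square_i\,v\in\mathsf{Cl}_\delta$ and $\mathsf{E}_u\circ_i\mathsf{E}_v=0$ otherwise, and unit $\mathsf{E}_\epsilon$. Order: for $u,v$ of the same length, $u\preccurlyeq v$ iff $u(j)\le v(j)$ for all $j$. Fundamental basis: $\mathsf{F}_w:=\sum_{w'\in\mathsf{Cl}_\delta,\,w\preccurlyeq w'}\mu_\preccurlyeq(w,w')\,\mathsf{E}_{w'}$, where $\mu_\preccurlyeq$ is the Möbius function of the poset $\preccurlyeq$ on $\delta$-cliffs of a given size; equivalently $\mathsf{E}_w=\sum_{w'\in\mathsf{Cl}_\delta,\,w\preccurlyeq w'}\mathsf{F}_{w'}$. Homogeneous basis: $\mathsf{H}_w:=\sum_{w'\in\mathsf{Cl}_\delta,\,w'\preccurlyeq w}\mathsf{F}_{w'}$. Operation $\blacksquare_i$: for $w\in\mathsf{Cl}_\delta$ and $f:\{1,\dots,\ell(w)\}\to\mathbb{N}\setminus\{0\}$, let $\mathrm{m}^f_\delta(w)$ be the word of length $\ell(w)$ with $j$-th letter $\delta(f(j))$ if $w(j)=\delta(j)$, and $w(j)$ otherwise. For $u,v\in\mathsf{Cl}_\delta$ and $1\le i\le|u|$, $u\,\blacksquare_i\,v:=\mathrm{m}^f_\delta(u)\,\square_i\,\mathrm{m}^g_\delta(v)$, where $f(j):=j$ if $j\le i-1$, $f(j):=j+\ell(v)$ otherwise, and $g(j):=j+i-1$. (The word $u\,\blacksquare_i\,v$ need not be a $\delta$-cliff.) *)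

theory Defs
  imports Complex_Main "HOL-Library.Poly_Mapping"
begin

text \<open>
  Words on the natural numbers are lists, with letters numbered from 1. A range map is a function
  on the positive integers, encoded as a total function whose value at 0 is never used.
\<close>

type_synonym word = "nat list"
type_synonym range_map = "nat \<Rightarrow> nat"

definition letter :: "word \<Rightarrow> nat \<Rightarrow> nat" where
  "letter w i = w ! (i - 1)"

definition unimodal :: "range_map \<Rightarrow> bool" where
  "unimodal \<delta> \<longleftrightarrow>
     \<not> (\<exists>i1 i2 i3. 1 \<le> i1 \<and> i1 < i2 \<and> i2 < i3 \<and> \<delta> i1 > \<delta> i2 \<and> \<delta> i2 < \<delta> i3)"

definition cliffs :: "range_map \<Rightarrow> word set" where
  "cliffs \<delta> = {w. \<forall>i\<in>{1..length w}. letter w i \<le> \<delta> i}"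

definition word_size :: "word \<Rightarrow> nat" where
  "word_size w = length w + 1"

definition reduction :: "range_map \<Rightarrow> word \<Rightarrow> word" where
  "reduction \<delta> w = map (\<lambda>i. min (letter w i) (\<delta> i)) [1..<length w + 1]"

definition square :: "word \<Rightarrow> nat \<Rightarrow> word \<Rightarrow> word" where
  "square u i v = take (i - 1) u @ v @ drop (i - 1) u"

definition cliff_le :: "word \<Rightarrow> word \<Rightarrow> bool" (infix "\<preceq>" 50) where
  "u \<preceq> v \<longleftrightarrow> length u = length v \<and> (\<forall>j\<in>{1..length u}. letter u j \<le> letter v j)"

lemma cliff_le_sum_list_less:
  assumes "u \<preceq> v" "u \<noteq> v"
  shows "sum_list u < sum_list v"
proof -
  have len: "length u = length v"
    using assms(1) by (simp add: cliff_le_def)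
  have le: "u ! k \<le> v ! k" if "k < length u" for k
  proof -
    have "letter u (Suc k) \<le> letter v (Suc k)"
      using assms(1) that unfolding cliff_le_def by (auto simp: Suc_le_eq)
    then show ?thesis by (simp add: letter_def)
  qed
  obtain k where k: "k < length u" "u ! k \<noteq> v ! k"
    using assms(2) len by (auto simp: list_eq_iff_nth_eq)
  have "(\<Sum>j<length u. u ! j) < (\<Sum>j<length u. v ! j)"
    by (rule sum_strict_mono_ex1) (use le k in \<open>auto intro!: bexI[of _ k] simp: nat_less_le\<close>)
  then show ?thesis
    by (simp add: sum_list_sum_nth len atLeast0LessThan)
qed

text \<open>
  The Moebius function of the order on \<open>\<delta>\<close>-cliffs, by the usual recursion on intervals. Cliffs of
  different sizes are incomparable, so that there is no need to fix the size.
\<close>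

function mobius :: "range_map \<Rightarrow> word \<Rightarrow> word \<Rightarrow> int" where
  "mobius \<delta> u v =
     (if u = v then 1
      else if u \<preceq> v then - (\<Sum>w | w \<in> cliffs \<delta> \<and> u \<preceq> w \<and> w \<preceq> v \<and> w \<noteq> v. mobius \<delta> u w)
      else 0)"
  by pat_completeness auto
termination
  by (relation "measure (\<lambda>(\<delta>, u, v). sum_list v)") (auto intro: cliff_le_sum_list_less)

declare mobius.simps [simp del]

text \<open>
  Elements of the operad are finite linear combinations of words; \<open>Poly_Mapping.single w c\<close> is
  \<open>c\<close> times the basis element indexed by \<open>w\<close>, of arity \<open>word_size w\<close>.
\<close>

definition basis_E :: "word \<Rightarrow> (word \<Rightarrow>\<^sub>0 'k::field_char_0)" where
  "basis_E w = Poly_Mapping.single w 1"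

definition basis_F :: "range_map \<Rightarrow> word \<Rightarrow> (word \<Rightarrow>\<^sub>0 'k::field_char_0)" where
  "basis_F \<delta> w =
     (\<Sum>w' | w' \<in> cliffs \<delta> \<and> w \<preceq> w'. Poly_Mapping.single w' (of_int (mobius \<delta> w w')))"

definition basis_H :: "range_map \<Rightarrow> word \<Rightarrow> (word \<Rightarrow>\<^sub>0 'k::field_char_0)" where
  "basis_H \<delta> w = (\<Sum>w' | w' \<in> cliffs \<delta> \<and> w' \<preceq> w. basis_F \<delta> w')"

text \<open>
  The bilinear extension of the composition of basis elements. It is meaningful when \<open>x\<close> and \<open>y\<close>
  are supported on \<open>\<delta>\<close>-cliffs, \<open>x\<close> is homogeneous of some arity \<open>n\<close> and \<open>1 \<le> i \<le> n\<close>.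
\<close>

definition pcomp ::
  "range_map \<Rightarrow> nat \<Rightarrow> (word \<Rightarrow>\<^sub>0 'k) \<Rightarrow> (word \<Rightarrow>\<^sub>0 'k) \<Rightarrow> (word \<Rightarrow>\<^sub>0 'k::field_char_0)" where
  "pcomp \<delta> i x y =
     (\<Sum>u\<in>Poly_Mapping.keys x. \<Sum>v\<in>Poly_Mapping.keys y.
        if square u i v \<in> cliffs \<delta>
        then Poly_Mapping.single (square u i v) (Poly_Mapping.lookup x u * Poly_Mapping.lookup y v)
        else 0)"

lemma pcomp_basis_E:
  "pcomp \<delta> i (basis_E u) (basis_E v) =
     (if square u i v \<in> cliffs \<delta> then basis_E (square u i v) else 0)"
  by (simp add: pcomp_def basis_E_def)

definition lift_max :: "range_map \<Rightarrow> (nat \<Rightarrow> nat) \<Rightarrow> word \<Rightarrow> word" where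
  "lift_max \<delta> f w =
     map (\<lambda>j. if letter w j = \<delta> j then \<delta> (f j) else letter w j) [1..<length w + 1]"

definition black_square :: "range_map \<Rightarrow> word \<Rightarrow> nat \<Rightarrow> word \<Rightarrow> word" where
  "black_square \<delta> u i v =
     square (lift_max \<delta> (\<lambda>j. if j \<le> i - 1 then j else j + length v) u) i
            (lift_max \<delta> (\<lambda>j. j + i - 1) v)"

end

theory Submission
  imports Defs "HOL-Library.FuncSet"
begin

text \<open>
  Cliffs of a given size form a product of chains, so the expansion of \<open>H\<^sub>w\<close> in the \<open>E\<close> basis factors
  over the positions: at position \<open>j\<close> the factor is \<open>e\<^sub>0 - e\<^bsub>a + 1\<^esub>\<close> with \<open>a = w(j)\<close>, where a letter
  exceeding \<open>\<delta>(j)\<close> counts as zero. Composition moves each factor to a new position \<open>j'\<close> and kills the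
  letters exceeding \<open>\<delta>(j')\<close>. The result is again a factor of this form, with \<open>a\<close> replaced by
  \<open>\<delta>(j')\<close> if \<open>a = \<delta>(j)\<close> and by \<open>min a (\<delta>(j'))\<close> otherwise.
\<close>

section \<open>Sums over boxes of words, each position ranging over its own set\<close>

lemma bij_betw_PiE_lists:
  "bij_betw (\<lambda>g. map g [0..<n]) (PiE {..<n} B) {w. length w = n \<and> (\<forall>j<n. w ! j \<in> B j)}"
  by (rule bij_betw_byWitness[where f' = "\<lambda>w. restrict (\<lambda>j. w ! j) {..<n}"])
    (auto simp: PiE_def extensional_def fun_eq_iff intro!: nth_equalityI)

lemma finite_lists_nth_in:
  assumes "\<And>j. j < n \<Longrightarrow> finite (B j)"
  shows "finite {w. length w = n \<and> (\<forall>j<n. w ! j \<in> B j)}"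
proof -
  have "finite (PiE {..<n} B)"
    using assms by (intro finite_PiE) auto
  then show ?thesis
    using bij_betw_finite[OF bij_betw_PiE_lists] by blast
qed

text \<open>Distributivity, transported from functions to words. It reduces a sum over an interval
  of the order to sums over single letters.\<close>

lemma sum_lists_prod_nth:
  fixes f :: "nat \<Rightarrow> 'a \<Rightarrow> 'b::comm_semiring_1"
  assumes "\<And>j. j < n \<Longrightarrow> finite (B j)"
  shows "(\<Sum>w | length w = n \<and> (\<forall>j<n. w ! j \<in> B j). \<Prod>j<n. f j (w ! j)) = (\<Prod>j<n. \<Sum>b\<in>B j. f j b)"
proof -
  have "(\<Prod>j<n. \<Sum>b\<in>B j. f j b) = (\<Sum>g\<in>PiE {..<n} B. \<Prod>j<n. f j (g j))"
    using assms by (intro prod_sum_PiE) auto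
  also have "\<dots> = (\<Sum>g\<in>PiE {..<n} B. \<Prod>j<n. f j (map g [0..<n] ! j))"
    by simp
  also have "\<dots> = (\<Sum>w | length w = n \<and> (\<forall>j<n. w ! j \<in> B j). \<Prod>j<n. f j (w ! j))"
    by (rule sum.reindex_bij_betw[OF bij_betw_PiE_lists])
  finally show ?thesis ..
qed

section \<open>Cliffs, their order and its Moebius function, with positions counted from 0\<close>

lemma ball_letter_iff: "(\<forall>j\<in>{1..n}. P j (letter w j)) \<longleftrightarrow> (\<forall>j<n. P (Suc j) (w ! j))"
  unfolding letter_def image_Suc_lessThan[symmetric] by auto

lemma mem_cliffs_iff: "w \<in> cliffs \<delta> \<longleftrightarrow> (\<forall>j<length w. w ! j \<le> \<delta> (Suc j))"
  unfolding cliffs_def mem_Collect_eq by (rule ball_letter_iff)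

lemma cliff_le_iff: "u \<preceq> v \<longleftrightarrow> length u = length v \<and> (\<forall>j<length u. u ! j \<le> v ! j)"
  unfolding cliff_le_def letter_def image_Suc_lessThan[symmetric] by auto

lemma cliff_le_refl: "u \<preceq> u"
  by (simp add: cliff_le_iff)

lemma cliff_le_mem_cliffs: "u \<preceq> v \<Longrightarrow> v \<in> cliffs \<delta> \<Longrightarrow> u \<in> cliffs \<delta>"
  unfolding cliff_le_iff mem_cliffs_iff by (metis order_trans)

text \<open>The Moebius function of the chain of natural numbers, that is, the case of a single
  letter.\<close>

definition mobius_letter :: "nat \<Rightarrow> nat \<Rightarrow> int" where
  "mobius_letter a b = of_bool (b = a) - of_bool (b = Suc a)"

text \<open>The relation that characterises a Moebius function: the 1 at \<open>a\<close> and the -1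
  at \<open>Suc a\<close> cancel as soon as \<open>c\<close> exceeds \<open>a\<close>.\<close>

lemma sum_mobius_letter_upper:
  assumes "a \<le> c"
  shows "(\<Sum>b\<in>{a..c}. mobius_letter a b) = of_bool (a = c)"
  using assms
  by (auto simp: mobius_letter_def of_bool_def sum_subtractf)

text \<open>The coefficient at \<open>b\<close> of the homogeneous element of index \<open>a\<close>
  on the unbounded chain.\<close>

definition hom_letter :: "nat \<Rightarrow> nat \<Rightarrow> int" where
  "hom_letter a b = of_bool (b = 0) - of_bool (b = Suc a)"

text \<open>Only \<open>a' = b\<close> and the predecessor of \<open>b\<close> contribute. They
  cancel unless \<open>b = 0\<close>, which has no predecessor, or \<open>b = Suc a\<close>, where
  only the predecessor lies in the range.\<close>

lemma sum_mobius_letter_lower: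
  "(\<Sum>a'\<in>{..min a b}. mobius_letter a' b) = hom_letter a b"
proof (cases b)
  case (Suc c)
  then show ?thesis
    by (auto simp: mobius_letter_def hom_letter_def of_bool_def sum_subtractf)
qed (auto simp: mobius_letter_def hom_letter_def)

text \<open>The product of the one-letter functions obeys the recursion defining
  \<open>mobius\<close>: it sums to 0 over the interval between distinct \<open>u\<close> and
  \<open>v\<close>. Words strictly below \<open>v\<close> have a smaller letter sum, whence the
  induction.\<close>

lemma mobius_eq_prod:
  assumes "v \<in> cliffs \<delta>" and "u \<preceq> v"
  shows "mobius \<delta> u v = (\<Prod>j<length u. mobius_letter (u ! j) (v ! j))"
  using assms
proof (induction "sum_list v" arbitrary: v rule: less_induct)
  case less
  let ?n = "length u"
  let ?p = "\<lambda>w. \<Prod>j<?n. mobius_letter (u ! j) (w ! j)"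
  \<comment> \<open>The interval from \<open>u\<close> to \<open>v\<close> is a box; its words are
    cliffs because cliffs are closed downwards.\<close>
  let ?I = "{w. length w = ?n \<and> (\<forall>j<?n. w ! j \<in> {u ! j..v ! j})}"
  show ?case
  proof (cases "u = v")
    case True
    then show ?thesis
      using mobius.simps[of \<delta> v v] by (simp add: mobius_letter_def)
  next
    case False
    have I: "w \<in> ?I \<longleftrightarrow> w \<in> cliffs \<delta> \<and> u \<preceq> w \<and> w \<preceq> v" for w
    proof -
      have "w \<in> ?I \<longleftrightarrow> u \<preceq> w \<and> w \<preceq> v"
        using less.prems(2) unfolding cliff_le_iff mem_Collect_eq atLeastAtMost_iff by metis
      then show ?thesis
        using less.prems(1) cliff_le_mem_cliffs by blast
    qed
    have fin: "finite ?I"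
      by (rule finite_lists_nth_in) simp
    have vI: "v \<in> ?I"
      using I less.prems cliff_le_refl by blast
    have len: "length u = length v" and le: "\<And>j. j < ?n \<Longrightarrow> u ! j \<le> v ! j"
      using less.prems(2) by (auto simp: cliff_le_iff)
    have "sum ?p ?I = (\<Prod>j<?n. \<Sum>b\<in>{u ! j..v ! j}. mobius_letter (u ! j) b)"
      by (rule sum_lists_prod_nth) simp
    also have "\<dots> = (\<Prod>j<?n. of_bool (u ! j = v ! j))"
      using le by (intro prod.cong refl sum_mobius_letter_upper) auto
    \<comment> \<open>A position where \<open>u\<close> and \<open>v\<close> differ contributes the
      factor 0.\<close>
    also have "\<dots> = 0"
      using False len by (auto simp: list_eq_iff_nth_eq)
    finally have zero: "sum ?p ?I = 0" .
    have "mobius \<delta> u v = - (\<Sum>w | w \<in> cliffs \<delta> \<and> u \<preceq> w \<and> w \<preceq> v \<and> w \<noteq> v. mobius \<delta> u w)"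
      using False less.prems(2) mobius.simps[of \<delta> u v] by (simp only: if_False if_True)
    also have "{w. w \<in> cliffs \<delta> \<and> u \<preceq> w \<and> w \<preceq> v \<and> w \<noteq> v} = ?I - {v}"
      using I by blast
    also have "(\<Sum>w\<in>?I - {v}. mobius \<delta> u w) = sum ?p (?I - {v})"
    proof (rule sum.cong[OF refl])
      fix w assume "w \<in> ?I - {v}"
      then have "w \<in> cliffs \<delta>" "u \<preceq> w" "w \<preceq> v" "w \<noteq> v"
        using I by blast+
      then show "mobius \<delta> u w = ?p w"
        using less.hyps cliff_le_sum_list_less by blast
    qed
    also have "- \<dots> = ?p v"
      using zero fin vI by (simp add: sum_diff1)
    finally show ?thesis .
  qed
qed

section \<open>Coefficients of the fundamental and homogeneous bases in the basis E\<close>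

lemma lookup_basis_F:
  "Poly_Mapping.lookup (basis_F \<delta> w :: word \<Rightarrow>\<^sub>0 'k::field_char_0) x =
     (if x \<in> cliffs \<delta> \<and> w \<preceq> x then of_int (mobius \<delta> w x) else 0)"
proof -
  \<comment> \<open>A sum over an infinite set would be 0 by default.\<close>
  have "finite {w'. w' \<in> cliffs \<delta> \<and> w \<preceq> w'}"
    by (rule finite_subset[OF _ finite_lists_nth_in[of "length w" "\<lambda>j. {..\<delta> (Suc j)}"]])
      (auto simp: mem_cliffs_iff cliff_le_iff)
  then show ?thesis
    by (simp add: basis_F_def lookup_sum lookup_single when_def)
qed

text \<open>The truncation records that only cliffs occur. For \<open>a = \<delta> j\<close> it
  removes the term at \<open>Suc a\<close>, which is why maximal letters behave specially under
  composition.\<close>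

definition hom_coeff :: "range_map \<Rightarrow> nat \<Rightarrow> nat \<Rightarrow> nat \<Rightarrow> int" where
  "hom_coeff \<delta> j a b = (if b \<le> \<delta> j then hom_letter a b else 0)"

text \<open>The coefficient at a cliff \<open>w\<close> sums \<open>mobius \<delta> x w\<close> over
  the words \<open>x\<close> below both \<open>u\<close> and \<open>w\<close>. These form a box, so
  the sum factors into letterwise sums given by \<open>sum_mobius_letter_lower\<close>.\<close>

lemma lookup_basis_H:
  assumes "u \<in> cliffs \<delta>"
  shows "Poly_Mapping.lookup (basis_H \<delta> u :: word \<Rightarrow>\<^sub>0 'k::field_char_0) w =
     (if length w = length u
      then of_int (\<Prod>j<length u. hom_coeff \<delta> (Suc j) (u ! j) (w ! j)) else 0)"
proof -
  let ?n = "length u"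
  let ?I = "{x. length x = ?n \<and> (\<forall>j<?n. x ! j \<in> {..min (u ! j) (w ! j)})}"
  have fin: "finite {x. x \<in> cliffs \<delta> \<and> x \<preceq> u}"
    by (rule finite_subset[OF _ finite_lists_nth_in[of ?n "\<lambda>j. {..u ! j}"]])
      (auto simp: cliff_le_iff)
  have *: "Poly_Mapping.lookup (basis_H \<delta> u :: word \<Rightarrow>\<^sub>0 'k) w =
      (\<Sum>x | x \<in> cliffs \<delta> \<and> x \<preceq> u. if w \<in> cliffs \<delta> \<and> x \<preceq> w then of_int (mobius \<delta> x w) else 0)"
    by (simp add: basis_H_def lookup_sum lookup_basis_F)
  consider "length w \<noteq> ?n" | "length w = ?n" "w \<notin> cliffs \<delta>" | "length w = ?n" "w \<in> cliffs \<delta>"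
    by blast
  then show ?thesis
  proof cases
    case 1
    then show ?thesis unfolding * by (intro trans[OF sum.neutral]) (auto simp: cliff_le_iff)
  next
    case 2
    \<comment> \<open>A letter of \<open>w\<close> above its bound makes its factor vanish.\<close>
    then have "(\<Prod>j<?n. hom_coeff \<delta> (Suc j) (u ! j) (w ! j)) = 0"
      by (auto simp: mem_cliffs_iff hom_coeff_def)
    with 2 show ?thesis unfolding * by simp
  next
    case 3
    have I: "x \<in> ?I \<longleftrightarrow> x \<in> cliffs \<delta> \<and> x \<preceq> u \<and> x \<preceq> w" for x
    proof -
      have "x \<in> ?I \<longleftrightarrow> x \<preceq> u \<and> x \<preceq> w"
        using 3(1) unfolding cliff_le_iff mem_Collect_eq atMost_iff min.bounded_iff by metis
      then show ?thesis
        using assms cliff_le_mem_cliffs by blast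
    qed
    have "Poly_Mapping.lookup (basis_H \<delta> u :: word \<Rightarrow>\<^sub>0 'k) w = (\<Sum>x\<in>?I. of_int (mobius \<delta> x w))"
      unfolding * using fin I 3 by (intro sum.mono_neutral_cong_right) auto
    also have "\<dots> = of_int (\<Sum>x\<in>?I. \<Prod>j<?n. mobius_letter (x ! j) (w ! j))"
      unfolding of_int_sum
    proof (rule sum.cong[OF refl])
      fix x assume x: "x \<in> ?I"
      then have "x \<preceq> w" "length x = ?n"
        using I by auto
      with 3 show "(of_int (mobius \<delta> x w) :: 'k) = of_int (\<Prod>j<?n. mobius_letter (x ! j) (w ! j))"
        by (simp add: mobius_eq_prod)
    qed
    also have "(\<Sum>x\<in>?I. \<Prod>j<?n. mobius_letter (x ! j) (w ! j)) =
        (\<Prod>j<?n. \<Sum>a\<in>{..min (u ! j) (w ! j)}. mobius_letter a (w ! j))"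
      by (rule sum_lists_prod_nth) simp
    also have "\<dots> = (\<Prod>j<?n. hom_coeff \<delta> (Suc j) (u ! j) (w ! j))"
      using 3 by (intro prod.cong) (auto simp: sum_mobius_letter_lower hom_coeff_def mem_cliffs_iff)
    finally show ?thesis using 3 by simp
  qed
qed

section \<open>Coefficients of a partial composition\<close>

lemma square_eq_iff:
  assumes "length u = m" and "length v = n" and "1 \<le> i" and "i \<le> m + 1"
  shows "square u i v = w \<longleftrightarrow>
    length w = m + n \<and> u = take (i - 1) w @ drop (i - 1 + n) w \<and> v = take n (drop (i - 1) w)"
proof
  assume "square u i v = w"
  then show "length w = m + n \<and> u = take (i - 1) w @ drop (i - 1 + n) w \<and> v = take n (drop (i - 1) w)"
    using assms by (auto simp: square_def)
next
  assume r: "length w = m + n \<and> u = take (i - 1) w @ drop (i - 1 + n) w \<and> v = take n (drop (i - 1) w)"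
  then have "square u i v = take (i - 1) w @ take n (drop (i - 1) w) @ drop n (drop (i - 1) w)"
    using assms by (auto simp: square_def add.commute)
  then show "square u i v = w"
    by (simp only: append_take_drop_id)
qed

lemma nth_square_left:
  assumes "i - 1 \<le> length u" and "j < length u"
  shows "square u i v ! (if j < i - 1 then j else j + length v) = u ! j"
  using assms by (auto simp: square_def nth_append min_def)

lemma nth_square_right:
  assumes "i - 1 \<le> length u" and "j < length v"
  shows "square u i v ! (i - 1 + j) = v ! j"
  using assms by (simp add: square_def nth_append)

text \<open>With the lengths fixed by homogeneity, \<open>square\<close> is injective: only the pair
  obtained by cutting the middle block out of \<open>w\<close> can contribute.\<close>

lemma lookup_pcomp:
  fixes x y :: "word \<Rightarrow>\<^sub>0 'k::field_char_0"
  assumes x: "\<And>u. u \<in> Poly_Mapping.keys x \<Longrightarrow> length u = m"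
    and y: "\<And>v. v \<in> Poly_Mapping.keys y \<Longrightarrow> length v = n"
    and i: "1 \<le> i" "i \<le> m + 1"
  shows "Poly_Mapping.lookup (pcomp \<delta> i x y) w =
    (if w \<in> cliffs \<delta> \<and> length w = m + n
     then Poly_Mapping.lookup x (take (i - 1) w @ drop (i - 1 + n) w)
        * Poly_Mapping.lookup y (take n (drop (i - 1) w))
     else 0)"
proof -
  define u0 where "u0 = take (i - 1) w @ drop (i - 1 + n) w"
  define v0 where "v0 = take n (drop (i - 1) w)"
  define P where "P \<longleftrightarrow> w \<in> cliffs \<delta> \<and> length w = m + n"
  have sq: "square u i v = w \<longleftrightarrow> length w = m + n \<and> u = u0 \<and> v = v0"
    if "u \<in> Poly_Mapping.keys x" "v \<in> Poly_Mapping.keys y" for u v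
    unfolding u0_def v0_def using that x y i by (intro square_eq_iff) auto
  have "Poly_Mapping.lookup (pcomp \<delta> i x y) w =
    (\<Sum>u\<in>Poly_Mapping.keys x. \<Sum>v\<in>Poly_Mapping.keys y.
       if square u i v = w \<and> w \<in> cliffs \<delta>
       then Poly_Mapping.lookup x u * Poly_Mapping.lookup y v else 0)"
    unfolding pcomp_def lookup_sum
    by (intro sum.cong refl) (auto simp: lookup_single when_def)
  \<comment> \<open>The conditions are nested so that each sum collapses to one term.\<close>
  also have "\<dots> = (\<Sum>u\<in>Poly_Mapping.keys x. \<Sum>v\<in>Poly_Mapping.keys y.
       if u = u0 then if v = v0 then if P
       then Poly_Mapping.lookup x u * Poly_Mapping.lookup y v else 0 else 0 else 0)"
    unfolding P_def by (intro sum.cong refl) (auto simp: sq)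
  also have "\<dots> = (\<Sum>u\<in>Poly_Mapping.keys x. if u = u0 then \<Sum>v\<in>Poly_Mapping.keys y.
       if v = v0 then if P then Poly_Mapping.lookup x u * Poly_Mapping.lookup y v else 0 else 0 else 0)"
    by (intro sum.cong refl) auto
  \<comment> \<open>If \<open>u0\<close> or \<open>v0\<close> is not a key, its coefficient is 0, so
    the formula still holds.\<close>
  also have "\<dots> = (if P then Poly_Mapping.lookup x u0 * Poly_Mapping.lookup y v0 else 0)"
    by (simp add: in_keys_iff)
  finally show ?thesis unfolding P_def u0_def v0_def .
qed

text \<open>If \<open>a = \<delta> j\<close>, the term at the successor is cut off on both sides and
  only \<open>b = 0\<close> counts. If \<open>a < \<delta> j\<close>, the term at
  \<open>Suc a\<close> is present at \<open>j\<close>; at \<open>k\<close> it survives when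
  \<open>a < \<delta> k\<close>, and otherwise the minimum is the maximal letter
  \<open>\<delta> k\<close>, while \<open>b \<le> \<delta> k\<close> excludes
  \<open>b = Suc a\<close>.\<close>

lemma hom_coeff_move:
  assumes "a \<le> \<delta> j" and "b \<le> \<delta> k"
  shows "hom_coeff \<delta> k (min (if a = \<delta> j then \<delta> k else a) (\<delta> k)) b = hom_coeff \<delta> j a b"
  using assms by (auto simp: hom_coeff_def hom_letter_def min_def)

section \<open>Lifted and reduced words, and the positions of a composed word\<close>

lemma length_lift_max: "length (lift_max \<delta> f w) = length w"
  by (simp add: lift_max_def del: upt_Suc)

lemma nth_lift_max:
  "j < length w \<Longrightarrow> lift_max \<delta> f w ! j = (if w ! j = \<delta> (Suc j) then \<delta> (f (Suc j)) else w ! j)"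
  by (simp add: lift_max_def letter_def nth_upt del: upt_Suc)

lemma length_reduction: "length (reduction \<delta> w) = length w"
  by (simp add: reduction_def del: upt_Suc)

lemma nth_reduction: "j < length w \<Longrightarrow> reduction \<delta> w ! j = min (w ! j) (\<delta> (Suc j))"
  by (simp add: reduction_def letter_def nth_upt del: upt_Suc)

lemma reduction_mem_cliffs: "reduction \<delta> w \<in> cliffs \<delta>"
  by (simp add: mem_cliffs_iff length_reduction nth_reduction)

text \<open>Sorts the positions of a composed word by origin: the outer word, shifted by
  \<open>n\<close> from position \<open>p\<close> on, and the inserted block starting at
  \<open>p\<close>.\<close>

lemma prod_split_insert:
  fixes f :: "nat \<Rightarrow> 'a::comm_monoid_mult"
  assumes "p \<le> m"
  shows "(\<Prod>j<m + n. f j) = (\<Prod>j<m. f (if j < p then j else j + n)) * (\<Prod>j<n. f (p + j))"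
proof -
  have "(\<Prod>j<m. f (if j < p then j else j + n)) = (\<Prod>j=0..<p. f j) * (\<Prod>j=p..<m. f (j + n))"
    using assms by (simp add: lessThan_atLeast0 flip: prod.atLeastLessThan_concat[of 0 p m])
  moreover have "(\<Prod>j=p..<m. f (j + n)) = (\<Prod>j=p + n..<m + n. f j)"
    by (simp add: prod.shift_bounds_nat_ivl)
  moreover have "(\<Prod>j<n. f (p + j)) = (\<Prod>j=p..<p + n. f j)"
    using prod.shift_bounds_nat_ivl[of f 0 p n]
    by (simp add: lessThan_atLeast0 add.commute)
  moreover have "(\<Prod>j<m + n. f j) =
      (\<Prod>j=0..<p. f j) * ((\<Prod>j=p..<p + n. f j) * (\<Prod>j=p + n..<m + n. f j))"
    using assms by (simp add: lessThan_atLeast0 prod.atLeastLessThan_concat)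
  ultimately show ?thesis by (simp add: ac_simps)
qed

theorem proposition2p2p4:
  fixes \<delta> :: range_map and u v :: word and i :: nat
  assumes "unimodal \<delta>"
    and "u \<in> cliffs \<delta>" and "v \<in> cliffs \<delta>"
    and "1 \<le> i" and "i \<le> word_size u"
  shows "pcomp \<delta> i (basis_H \<delta> u) (basis_H \<delta> v) =
    (basis_H \<delta> (reduction \<delta> (black_square \<delta> u i v)) :: word \<Rightarrow>\<^sub>0 'k::field_char_0)"
proof (rule poly_mapping_eqI)
  fix w :: word
  define m n p where "m = length u" and "n = length v" and "p = i - 1"
  define r where "r = reduction \<delta> (black_square \<delta> u i v)"
  \<comment> \<open>The position, counted from 0, that letter \<open>j\<close> of \<open>u\<close>
    takes in the composed word.\<close>
  define q where "q j = (if j < p then j else j + n)" for j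
  have p: "p \<le> m"
    using assms(4,5) by (simp add: m_def p_def word_size_def)
  define U V where "U = lift_max \<delta> (\<lambda>j. if j \<le> p then j else j + n) u"
    and "V = lift_max \<delta> (\<lambda>j. j + i - 1) v"
  have bs: "black_square \<delta> u i v = square U i V"
    by (simp only: black_square_def U_def V_def n_def p_def)
  have len_U: "length U = m" and len_V: "length V = n"
    by (simp_all add: U_def V_def length_lift_max m_def n_def)
  have len_bs: "length (black_square \<delta> u i v) = m + n"
    using p by (simp add: bs square_def len_U len_V)
  then have len_r: "length r = m + n"
    by (simp add: r_def length_reduction)
  \<comment> \<open>This and \<open>r_v\<close> give the letters of \<open>r\<close> the form
    required by \<open>hom_coeff_move\<close>.\<close>
  have r_u: "r ! q j = min (if u ! j = \<delta> (Suc j) then \<delta> (Suc (q j)) else u ! j) (\<delta> (Suc (q j)))"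
    if "j < m" for j
  proof -
    have "q j < length (black_square \<delta> u i v)"
      using that len_bs by (simp add: q_def)
    moreover have "black_square \<delta> u i v ! q j = U ! j"
      using nth_square_left[of i U j V] that p
      unfolding bs len_U len_V q_def p_def by blast
    \<comment> \<open>The map lifting \<open>u\<close> counts positions from 1, whereas
      \<open>q\<close> counts from 0.\<close>
    moreover have "(if Suc j \<le> p then Suc j else Suc j + n) = Suc (q j)"
      by (simp add: q_def)
    ultimately show ?thesis
      using that by (simp only: r_def nth_reduction nth_lift_max m_def U_def)
  qed
  have r_v: "r ! (p + j) = min (if v ! j = \<delta> (Suc j) then \<delta> (Suc (p + j)) else v ! j) (\<delta> (Suc (p + j)))"
    if "j < n" for j
  proof -
    have "p + j < length (black_square \<delta> u i v)"
      using that p len_bs by simp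
    moreover have "black_square \<delta> u i v ! (p + j) = V ! j"
      using nth_square_right[of i U j V] that p
      unfolding bs len_U len_V p_def by blast
    moreover have "Suc j + i - 1 = Suc (p + j)"
      using assms(4) by (simp add: p_def)
    ultimately show ?thesis
      using that by (simp only: r_def nth_reduction nth_lift_max n_def V_def)
  qed
  \<comment> \<open>The expansion applies because \<open>r\<close>, being a reduction, is a
    cliff.\<close>
  have H: "Poly_Mapping.lookup (basis_H \<delta> r :: word \<Rightarrow>\<^sub>0 'k) w =
      (if length w = m + n then of_int (\<Prod>j<m + n. hom_coeff \<delta> (Suc j) (r ! j) (w ! j)) else 0)"
    using lookup_basis_H[OF reduction_mem_cliffs, of \<delta> "black_square \<delta> u i v" w]
    by (simp only: r_def[symmetric] len_r)
  \<comment> \<open>Homogeneity of the H elements, as \<open>lookup_pcomp\<close> requires.\<close>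
  have keys: "length w' = length x"
    if "w' \<in> Poly_Mapping.keys (basis_H \<delta> x :: word \<Rightarrow>\<^sub>0 'k)" "x \<in> cliffs \<delta>" for w' x
    using that by (auto simp: in_keys_iff lookup_basis_H split: if_splits)
  have L: "Poly_Mapping.lookup (pcomp \<delta> i (basis_H \<delta> u) (basis_H \<delta> v) :: word \<Rightarrow>\<^sub>0 'k) w =
    (if w \<in> cliffs \<delta> \<and> length w = m + n
     then Poly_Mapping.lookup (basis_H \<delta> u) (take p w @ drop (p + n) w)
        * Poly_Mapping.lookup (basis_H \<delta> v) (take n (drop p w))
     else 0)"
    unfolding p_def using assms(4,5)
    by (intro lookup_pcomp)
      (auto simp: m_def n_def word_size_def dest: keys[OF _ assms(2)] keys[OF _ assms(3)])
  consider "length w \<noteq> m + n" | "length w = m + n" "w \<notin> cliffs \<delta>" | "length w = m + n" "w \<in> cliffs \<delta>"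
    by blast
  then have "Poly_Mapping.lookup (pcomp \<delta> i (basis_H \<delta> u) (basis_H \<delta> v) :: word \<Rightarrow>\<^sub>0 'k) w =
    Poly_Mapping.lookup (basis_H \<delta> r) w"
  proof cases
    case 1
    then show ?thesis by (simp add: L H)
  next
    case 2
    \<comment> \<open>The composition discards words that are not cliffs; on the other side a factor
      vanishes.\<close>
    then show ?thesis by (auto simp: L H mem_cliffs_iff hom_coeff_def)
  next
    case 3
    have w: "w ! j \<le> \<delta> (Suc j)" if "j < m + n" for j
      using 3 that by (simp add: mem_cliffs_iff)
    have w_u: "(take p w @ drop (p + n) w) ! j = w ! q j" if "j < m" for j
      using 3 p that by (auto simp: nth_append q_def add.commute)
    have w_v: "take n (drop p w) ! j = w ! (p + j)" if "j < n" for j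
      using 3 p that by simp
    have "Poly_Mapping.lookup (basis_H \<delta> u :: word \<Rightarrow>\<^sub>0 'k) (take p w @ drop (p + n) w) =
        of_int (\<Prod>j<m. hom_coeff \<delta> (Suc j) (u ! j) ((take p w @ drop (p + n) w) ! j))"
      using 3 p assms(2) by (simp add: lookup_basis_H m_def)
    also have "(\<Prod>j<m. hom_coeff \<delta> (Suc j) (u ! j) ((take p w @ drop (p + n) w) ! j)) =
        (\<Prod>j<m. hom_coeff \<delta> (Suc (q j)) (r ! q j) (w ! q j))"
    proof (rule prod.cong[OF refl])
      fix j assume "j \<in> {..<m}"
      then have j: "j < m" by simp
      then have "u ! j \<le> \<delta> (Suc j)" "w ! q j \<le> \<delta> (Suc (q j))"
        using assms(2) w by (auto simp: mem_cliffs_iff m_def q_def)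
      from hom_coeff_move[of _ \<delta>, OF this] show "hom_coeff \<delta> (Suc j) (u ! j) ((take p w @ drop (p + n) w) ! j) =
          hom_coeff \<delta> (Suc (q j)) (r ! q j) (w ! q j)"
        by (simp only: r_u[OF j] w_u[OF j])
    qed
    finally have U: "Poly_Mapping.lookup (basis_H \<delta> u :: word \<Rightarrow>\<^sub>0 'k) (take p w @ drop (p + n) w) =
        of_int (\<Prod>j<m. hom_coeff \<delta> (Suc (q j)) (r ! q j) (w ! q j))" .
    have "Poly_Mapping.lookup (basis_H \<delta> v :: word \<Rightarrow>\<^sub>0 'k) (take n (drop p w)) =
        of_int (\<Prod>j<n. hom_coeff \<delta> (Suc j) (v ! j) (take n (drop p w) ! j))"
      using 3 p assms(3) by (simp add: lookup_basis_H n_def)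
    also have "(\<Prod>j<n. hom_coeff \<delta> (Suc j) (v ! j) (take n (drop p w) ! j)) =
        (\<Prod>j<n. hom_coeff \<delta> (Suc (p + j)) (r ! (p + j)) (w ! (p + j)))"
    proof (rule prod.cong[OF refl])
      fix j assume "j \<in> {..<n}"
      then have j: "j < n" by simp
      then have "v ! j \<le> \<delta> (Suc j)" "w ! (p + j) \<le> \<delta> (Suc (p + j))"
        using assms(3) w p by (auto simp: mem_cliffs_iff n_def)
      from hom_coeff_move[of _ \<delta>, OF this] show "hom_coeff \<delta> (Suc j) (v ! j) (take n (drop p w) ! j) =
          hom_coeff \<delta> (Suc (p + j)) (r ! (p + j)) (w ! (p + j))"
        by (simp only: r_v[OF j] w_v[OF j])
    qed
    finally have V: "Poly_Mapping.lookup (basis_H \<delta> v :: word \<Rightarrow>\<^sub>0 'k) (take n (drop p w)) =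
        of_int (\<Prod>j<n. hom_coeff \<delta> (Suc (p + j)) (r ! (p + j)) (w ! (p + j)))" .
    \<comment> \<open>The factors coming from \<open>u\<close> and from \<open>v\<close> reassemble
      into the product over all positions of \<open>r\<close>.\<close>
    show ?thesis
      using 3 by (simp add: L H U V prod_split_insert[OF p, where n = n] flip: q_def)
  qed
  then show "Poly_Mapping.lookup (pcomp \<delta> i (basis_H \<delta> u) (basis_H \<delta> v) :: word \<Rightarrow>\<^sub>0 'k) w =
    Poly_Mapping.lookup (basis_H \<delta> (reduction \<delta> (black_square \<delta> u i v))) w"
    by (simp only: r_def)
qed

end
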